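(* For every $k\in\mathbb{N}$, $\mathrm{ADT}_k\subsetneq\mathrm{ADT}_{k+1}$ as classes of definable languages: every language definable by a tree in $\mathrm{ADT}_k$ is definable by a tree in $\mathrm{ADT}_{k+1}$, and some language definable by a tree in $\mathrm{ADT}_{k+1}$ is not definable by any tree in $\mathrm{ADT}_k$. This holds even if $\mathrm{Prop}=\{p\}$ is a singleton.
   Context: Let $\mathrm{Prop}$ be a finite set of propositions (with $\top := p\lor\neg p$ for $p\in\mathrm{Prop}$, and $\bot:=\neg\top$) and let $\Sigma = 2^{\mathrm{Prop}}$ be the alphabet of valuations. A trace is a word in $\Sigma^*$; $\varepsilon$ is the empty trace. The set $\mathrm{ADT}$ of attack-defense trees is defined inductively: the special leaf $\epsilon$ and every propositional formula $\gamma$ over $\mathrm{Prop}$ are in $\mathrm{ADT}$; if $\theta_1,\dots,\theta_n\in\mathrm{ADT}$ then $\mathrm{OR}(\theta_1,\dots,\theta_n)$, $\mathrm{SAND}(\theta_1,\dots,\theta_n)$, $\mathrm{AND}(\theta_1,\dots,\theta_n)\in\mathrm{ADT}$; if $\theta,\theta'\in\mathrm{ADT}$ then $\mathrm{C}(\theta,\theta')\in\mathrm{ADT}$. Semantics $[\![\theta]\!]\subseteq\Sigma^*$: $[\![\epsilon]\!]=\{\varepsilon\}$; $[\![\gamma]\!]=\{v_1\cdots v_n\in\Sigma^* : n\ge 1,\ v_n\models\gamma\}$; $\mathrm{OR}$ is interpreted as union, $\mathrm{SAND}$ as concatenation (in the given order), $[\![\mathrm{C}(\theta_1,\theta_2)]\!]=[\![\theta_1]\!]\setminus[\![\theta_2]\!]$,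 and $[\![\mathrm{AND}(\theta_1,\dots,\theta_n)]\!]=\bigcup_{i}\big([\![\theta_i]\!]\cap\bigcap_{j\ne i}[\![\theta_j]\!]\cdot\Sigma^*\big)$. Countermeasure-depth: $\mathrm{cd}(\epsilon)=\mathrm{cd}(\gamma)=0$; $\mathrm{cd}(\mathrm{OP}(\theta_1,\dots,\theta_n))=\max_i\mathrm{cd}(\theta_i)$ for $\mathrm{OP}\in\{\mathrm{OR},\mathrm{SAND},\mathrm{AND}\}$; $\mathrm{cd}(\mathrm{C}(\theta_1,\theta_2))=\max\{\mathrm{cd}(\theta_1),\mathrm{cd}(\theta_2)+1\}$. $\mathrm{ADT}_k=\{\theta\in\mathrm{ADT}:\mathrm{cd}(\theta)\le k\}$. A language $L\subseteq\Sigma^*$ is definable in $\mathrm{ADT}_k$ if $L=[\![\theta]\!]$ for some $\theta\in\mathrm{ADT}_k$. *)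

theory Defs
  imports Main
begin

text \<open>The finite nonempty set of propositions is a type \<open>'p\<close> of class \<open>finite\<close>. A valuation is the
  set of propositions that are true, so the alphabet is the type \<open>'p set\<close>.\<close>

datatype 'p form =
    Atom 'p
  | Neg "'p form"
  | Conj "'p form" "'p form"
  | Disj "'p form" "'p form"

type_synonym 'p trace = "'p set list"

primrec models :: "'p set \<Rightarrow> 'p form \<Rightarrow> bool" (infix "\<Turnstile>" 50) where
  "v \<Turnstile> Atom p \<longleftrightarrow> p \<in> v"
| "v \<Turnstile> Neg \<gamma> \<longleftrightarrow> \<not> v \<Turnstile> \<gamma>"
| "v \<Turnstile> Conj \<gamma> \<delta> \<longleftrightarrow> v \<Turnstile> \<gamma> \<and> v \<Turnstile> \<delta>"
| "v \<Turnstile> Disj \<gamma> \<delta> \<longleftrightarrow> v \<Turnstile> \<gamma> \<or> v \<Turnstile> \<delta>"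

text \<open>The datatype also contains OR, SAND and AND nodes without children; the set \<open>ADT\<close> below
  excludes them, as the maximum in the definition of \<open>cd\<close> needs at least one child.\<close>

datatype 'p tree =
    Eps
  | Leaf "'p form"
  | OR "'p tree list"
  | SAND "'p tree list"
  | AND "'p tree list"
  | Ctr "'p tree" "'p tree"

inductive_set ADT :: "'p tree set" where
  "Eps \<in> ADT"
| "Leaf \<gamma> \<in> ADT"
| "ts \<noteq> [] \<Longrightarrow> \<forall>t\<in>set ts. t \<in> ADT \<Longrightarrow> OR ts \<in> ADT"
| "ts \<noteq> [] \<Longrightarrow> \<forall>t\<in>set ts. t \<in> ADT \<Longrightarrow> SAND ts \<in> ADT"
| "ts \<noteq> [] \<Longrightarrow> \<forall>t\<in>set ts. t \<in> ADT \<Longrightarrow> AND ts \<in> ADT"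
| "t \<in> ADT \<Longrightarrow> t' \<in> ADT \<Longrightarrow> Ctr t t' \<in> ADT"

definition lconc :: "'a list set \<Rightarrow> 'a list set \<Rightarrow> 'a list set" (infixr "\<cdot>" 75) where
  "K \<cdot> L = {u @ v | u v. u \<in> K \<and> v \<in> L}"

definition and_lang :: "'a list set list \<Rightarrow> 'a list set" where
  "and_lang Ls =
    (\<Union>i<length Ls. Ls ! i \<inter> (\<Inter>j\<in>{..<length Ls} - {i}. Ls ! j \<cdot> UNIV))"

primrec sem :: "'p tree \<Rightarrow> 'p trace set" where
  "sem Eps = {[]}"
| "sem (Leaf \<gamma>) = {w. w \<noteq> [] \<and> last w \<Turnstile> \<gamma>}"
| "sem (OR ts) = \<Union> (set (map sem ts))"
| "sem (SAND ts) = foldr (\<cdot>) (map sem ts) {[]}"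
| "sem (AND ts) = and_lang (map sem ts)"
| "sem (Ctr t t') = sem t - sem t'"

primrec cd :: "'p tree \<Rightarrow> nat" where
  "cd Eps = 0"
| "cd (Leaf \<gamma>) = 0"
| "cd (OR ts) = Max (set (map cd ts))"
| "cd (SAND ts) = Max (set (map cd ts))"
| "cd (AND ts) = Max (set (map cd ts))"
| "cd (Ctr t t') = max (cd t) (cd t' + 1)"

definition ADT_upto :: "nat \<Rightarrow> 'p tree set" where
  "ADT_upto k = {t \<in> ADT. cd t \<le> k}"

definition definable_in :: "nat \<Rightarrow> 'p trace set \<Rightarrow> bool" where
  "definable_in k L \<longleftrightarrow> (\<exists>t \<in> ADT_upto k. L = sem t)"

end

theory Submission imports Defs begin

text \<open>For each depth \<open>k\<close> and number of rounds \<open>n\<close> the preorder \<open>game_le k n\<close> compares two words by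
  their last letters, by matching every factorisation of the left word, and by the reversed
  preorder of depth \<open>k - 1\<close>. A tree of countermeasure-depth at most \<open>k\<close> has a language that is
  upward closed for some \<open>n\<close>. Inserting \<open>v\<close> into a high power of \<open>u\<close> goes up at depth \<open>k + 1\<close>
  whenever \<open>v\<close> is below \<open>u\<close> at depth \<open>k\<close>. Iterating this gives words \<open>q\<close> that are paths from \<open>0\<close>
  to \<open>0\<close> in the strip \<open>[0, k]\<close>, reading a letter as an up or a down step, and that lie below
  \<open>q @ a # q\<close> at depth \<open>k\<close> although the latter has net height \<open>1\<close>. The language of all such paths
  has depth at most \<open>k + 1\<close>: a word leaves the strip of height \<open>m\<close> or ends at the wrong height iff
  it has a factor, prefix or suffix described by a path in a strip of height \<open>m - 1\<close>.\<close>

section \<open>A family of game preorders\<close>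

text \<open>This is all that the leaves \<open>Eps\<close> and \<open>Leaf \<gamma>\<close> can read
  off a word.\<close>

definition same_last :: "'a list \<Rightarrow> 'a list \<Rightarrow> bool" where
  "same_last u v \<longleftrightarrow> (u = [] \<longleftrightarrow> v = []) \<and> (u \<noteq> [] \<longrightarrow> last u = last v)"

lemma same_last_sym: "same_last u v \<Longrightarrow> same_last v u"
  by (auto simp: same_last_def)

lemma same_last_append:
  "same_last u v \<Longrightarrow> same_last u' v' \<Longrightarrow> same_last (u @ u') (v @ v')"
  by (auto simp: same_last_def)

text \<open>A split costs a round; a swap of the two words costs a level of \<open>k\<close> but no
  round. So \<open>k + n\<close> drops in every recursive call and serves as induction
  measure.\<close>

fun game_le :: "nat \<Rightarrow> nat \<Rightarrow> 'a list \<Rightarrow> 'a list \<Rightarrow> bool" where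
  "game_le k 0 u v \<longleftrightarrow> same_last u v"
| "game_le 0 (Suc n) u v \<longleftrightarrow> same_last u v \<and>
     (\<forall>x y. u = x @ y \<longrightarrow> (\<exists>x' y'. v = x' @ y' \<and> game_le 0 n x x' \<and> game_le 0 n y y'))"
| "game_le (Suc k) (Suc n) u v \<longleftrightarrow> same_last u v \<and> game_le k (Suc n) v u \<and>
     (\<forall>x y. u = x @ y \<longrightarrow>
       (\<exists>x' y'. v = x' @ y' \<and> game_le (Suc k) n x x' \<and> game_le (Suc k) n y y'))"

text \<open>This equation loops as a rewrite rule, since its right-hand side contains an instance of its
  left-hand side.\<close>

lemma game_le_Suc_iff:
  "game_le k (Suc n) u v \<longleftrightarrow> same_last u v \<and> (\<forall>k'. k = Suc k' \<longrightarrow> game_le k' (Suc n) v u) \<and>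
     (\<forall>x y. u = x @ y \<longrightarrow> (\<exists>x' y'. v = x' @ y' \<and> game_le k n x x' \<and> game_le k n y y'))"
  by (cases k) auto

declare game_le.simps(2,3) [simp del]

lemma game_le_SucI:
  assumes "same_last u v"
    and "\<And>k'. k = Suc k' \<Longrightarrow> game_le k' (Suc n) v u"
    and "\<And>x y. u = x @ y \<Longrightarrow> \<exists>x' y'. v = x' @ y' \<and> game_le k n x x' \<and> game_le k n y y'"
  shows "game_le k (Suc n) u v"
  by (rule game_le_Suc_iff[THEN iffD2]) (intro conjI allI impI assms)

lemma game_le_splitE:
  assumes "game_le k (Suc n) (x @ y) v"
  obtains x' y' where "v = x' @ y'" "game_le k n x x'" "game_le k n y y'"
  using assms[THEN game_le_Suc_iff[THEN iffD1], THEN conjunct2, THEN conjunct2, rule_format, OF refl]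
    that by blast

lemma game_le_same_last: "game_le k n u v \<Longrightarrow> same_last u v"
  by (cases n) (simp, simp, erule game_le_Suc_iff[THEN iffD1, THEN conjunct1])

lemma game_le_dual: "game_le (Suc k) n u v \<Longrightarrow> game_le k n v u"
  by (cases n) (simp add: same_last_sym, simp only: game_le.simps(3))

lemma game_le_refl: "game_le k n u u"
proof (induction "k + n" arbitrary: k n u rule: less_induct)
  case less
  show ?case
  proof (cases n)
    case 0
    then show ?thesis by (simp add: same_last_def)
  next
    case (Suc n')
    have "game_le k (Suc n') u u"
    proof (rule game_le_SucI)
      show "same_last u u" by (simp add: same_last_def)
      show "game_le k' (Suc n') u u" if "k = Suc k'" for k'
        using less[of k' "Suc n'" u] that Suc by simp
      show "\<exists>x' y'. u = x' @ y' \<and> game_le k n' x x' \<and> game_le k n' y y'" if "u = x @ y" for x y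
        using that by (intro exI[of _ x] exI[of _ y] conjI less) (simp_all add: Suc)
    qed
    then show ?thesis using Suc by simp
  qed
qed

lemma game_le_SucD: "game_le k (Suc n) u v \<Longrightarrow> game_le k n u v"
proof (induction "k + n" arbitrary: k n u v rule: less_induct)
  case less
  show ?case
  proof (cases n)
    case 0
    then show ?thesis using game_le_same_last[OF less.prems] by simp
  next
    case (Suc n')
    have "game_le k (Suc n') u v"
    proof (rule game_le_SucI)
      show "same_last u v" using game_le_same_last[OF less.prems] .
      show "game_le k' (Suc n') v u" if "k = Suc k'" for k'
        using less.hyps[OF _ game_le_dual[OF less.prems[unfolded that Suc]]] that Suc by simp
      show "\<exists>x' y'. v = x' @ y' \<and> game_le k n' x x' \<and> game_le k n' y y'" if u: "u = x @ y" for x y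
      proof -
        obtain x' y' where "v = x' @ y'" "game_le k (Suc n') x x'" "game_le k (Suc n') y y'"
          using less.prems unfolding u Suc by (rule game_le_splitE)
        then show ?thesis using less.hyps[of k n'] Suc by auto
      qed
    qed
    then show ?thesis using Suc by simp
  qed
qed

lemma game_le_antimono: "n \<le> n' \<Longrightarrow> game_le k n' u v \<Longrightarrow> game_le k n u v"
  by (induction n' rule: dec_induct) (auto dest: game_le_SucD)

lemma game_le_trans: "game_le k n u v \<Longrightarrow> game_le k n v w \<Longrightarrow> game_le k n u w"
proof (induction "k + n" arbitrary: k n u v w rule: less_induct)
  case less
  have sl: "same_last u w"
    using game_le_same_last[OF less.prems(1)] game_le_same_last[OF less.prems(2)]
    by (auto simp: same_last_def)
  show ?case
  proof (cases n)
    case 0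
    then show ?thesis using sl by simp
  next
    case (Suc n')
    have "game_le k (Suc n') u w"
    proof (rule game_le_SucI[OF sl])
      show "game_le k' (Suc n') w u" if "k = Suc k'" for k'
        using less.hyps[OF _ game_le_dual[OF less.prems(2)[unfolded that Suc]]
            game_le_dual[OF less.prems(1)[unfolded that Suc]]] that Suc by simp
      show "\<exists>x' y'. w = x' @ y' \<and> game_le k n' x x' \<and> game_le k n' y y'" if u: "u = x @ y" for x y
      proof -
        obtain x' y' where 1: "v = x' @ y'" "game_le k n' x x'" "game_le k n' y y'"
          using less.prems(1) unfolding u Suc by (rule game_le_splitE)
        obtain x'' y'' where 2: "w = x'' @ y''" "game_le k n' x' x''" "game_le k n' y' y''"
          using less.prems(2) unfolding 1 Suc by (rule game_le_splitE)
        have "game_le k n' x x''" using less.hyps[of k n'] Suc 1 2 by auto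
        moreover have "game_le k n' y y''" using less.hyps[of k n'] Suc 1 2 by auto
        ultimately show ?thesis using 2 by blast
      qed
    qed
    then show ?thesis using Suc by simp
  qed
qed

text \<open>A factorisation of \<open>u @ u'\<close> cuts inside \<open>u\<close> or inside
  \<open>u'\<close>. The matching cut is made in the corresponding factor, and the uncut factor is
  compared with one round fewer.\<close>

lemma game_le_append:
  "game_le k n u v \<Longrightarrow> game_le k n u' v' \<Longrightarrow> game_le k n (u @ u') (v @ v')"
proof (induction "k + n" arbitrary: k n u v u' v' rule: less_induct)
  case less
  have sl: "same_last (u @ u') (v @ v')"
    using less.prems by (intro same_last_append) (auto dest: game_le_same_last)
  show ?case
  proof (cases n)
    case 0
    then show ?thesis using sl by simp
  next
    case (Suc n')
    have IH: "game_le k n' x x' \<Longrightarrow> game_le k n' y y' \<Longrightarrow> game_le k n' (x @ y) (x' @ y')"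
      for x x' y y' :: "'a list"
      using less.hyps[of k n'] Suc by auto
    have le: "game_le k n' u v" "game_le k n' u' v'"
      using less.prems Suc by (auto intro: game_le_SucD)
    have "game_le k (Suc n') (u @ u') (v @ v')"
    proof (rule game_le_SucI[OF sl])
      show "game_le k' (Suc n') (v @ v') (u @ u')" if "k = Suc k'" for k'
        using less.hyps[OF _ game_le_dual[OF less.prems(1)[unfolded that Suc]]
            game_le_dual[OF less.prems(2)[unfolded that Suc]]] that Suc by simp
      show "\<exists>x' y'. v @ v' = x' @ y' \<and> game_le k n' x x' \<and> game_le k n' y y'"
        if eq: "u @ u' = x @ y" for x y
      proof -
        from eq consider z where "u = x @ z" "y = z @ u'" | z where "x = u @ z" "u' = z @ y"
          by (auto simp: append_eq_append_conv2)
        then show ?thesis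
        proof cases
          case 1
          obtain x' z' where "v = x' @ z'" "game_le k n' x x'" "game_le k n' z z'"
            using less.prems(1) unfolding 1 Suc by (rule game_le_splitE)
          then show ?thesis using IH[OF _ le(2)] 1 by (metis append.assoc)
        next
          case 2
          obtain z' y' where "v' = z' @ y'" "game_le k n' z z'" "game_le k n' y y'"
            using less.prems(2) unfolding 2 Suc by (rule game_le_splitE)
          then show ?thesis using IH[OF le(1)] 2 by (metis append.assoc)
        qed
      qed
    qed
    then show ?thesis using Suc by simp
  qed
qed

text \<open>A split of \<open>[c]\<close> has an empty side, so the other side can be matched with
  all of \<open>[d, c]\<close>. At depth 0 no reversed comparison arises.\<close>

lemma game_le_0_Cons: "game_le 0 n [c] [d, c]"
proof (induction n)
  case 0
  show ?case by (simp add: same_last_def)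
next
  case (Suc n)
  show ?case
  proof (rule game_le_SucI)
    show "same_last [c] [d, c]" by (simp add: same_last_def)
    fix x y assume "[c] = x @ y"
    then consider "x = []" "y = [c]" | "x = [c]" "y = []"
      by (auto simp: Cons_eq_append_conv)
    then show "\<exists>x' y'. [d, c] = x' @ y' \<and> game_le 0 n x x' \<and> game_le 0 n y y'"
    proof cases
      case 1
      then have "[d, c] = [] @ [d, c] \<and> game_le 0 n x [] \<and> game_le 0 n y [d, c]"
        using Suc game_le_refl by simp
      then show ?thesis by blast
    next
      case 2
      then have "[d, c] = [d, c] @ [] \<and> game_le 0 n x [d, c] \<and> game_le 0 n y []"
        using Suc game_le_refl by simp
      then show ?thesis by blast
    qed
  qed simp
qed

section \<open>Languages of countermeasure-depth \<open>k\<close> are upward closed\<close>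

definition up_closed :: "nat \<Rightarrow> nat \<Rightarrow> 'a list set \<Rightarrow> bool" where
  "up_closed k n L \<longleftrightarrow> (\<forall>u v. game_le k n u v \<longrightarrow> u \<in> L \<longrightarrow> v \<in> L)"

lemma up_closed_mono: "up_closed k n L \<Longrightarrow> n \<le> n' \<Longrightarrow> up_closed k n' L"
  unfolding up_closed_def by (meson game_le_antimono)

text \<open>The additional round is spent on the factorisation that witnesses membership in
  \<open>K \<cdot> L\<close>.\<close>

lemma up_closed_lconc:
  assumes "up_closed k n K" "up_closed k n L"
  shows "up_closed k (Suc n) (K \<cdot> L)"
  unfolding up_closed_def
proof (intro allI impI)
  fix u v assume le: "game_le k (Suc n) u v" and "u \<in> K \<cdot> L"
  then obtain x y where u: "u = x @ y" "x \<in> K" "y \<in> L"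
    by (auto simp: lconc_def)
  obtain x' y' where "v = x' @ y'" "game_le k n x x'" "game_le k n y y'"
    using le unfolding u by (rule game_le_splitE)
  then show "v \<in> K \<cdot> L"
    using assms u unfolding up_closed_def lconc_def by blast
qed

lemma up_closed_uniform:
  assumes "\<forall>L \<in> set Ls. \<exists>n. up_closed k n L"
  shows "\<exists>n. \<forall>L \<in> set Ls. up_closed k n L"
  using assms
proof (induction Ls)
  case (Cons L Ls)
  then obtain n n' where "up_closed k n L" "\<forall>L \<in> set Ls. up_closed k n' L" by auto
  then have "\<forall>L \<in> set (L # Ls). up_closed k (max n n') L"
    by (auto intro: up_closed_mono)
  then show ?case ..
qed simp

text \<open>The prefix conditions \<open>Ls ! j \<cdot> UNIV\<close> are concatenations and cost one
  round; unions and intersections cost none.\<close>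

lemma up_closed_and_lang:
  assumes "\<forall>L \<in> set Ls. up_closed k n L"
  shows "up_closed k (Suc n) (and_lang Ls)"
proof -
  have 1: "up_closed k (Suc n) (Ls ! i)" if "i < length Ls" for i
    using assms that by (auto intro: up_closed_mono[where n = n])
  have 2: "up_closed k (Suc n) (Ls ! i \<cdot> UNIV)" if "i < length Ls" for i
    using assms that by (intro up_closed_lconc) (auto simp: up_closed_def)
  show ?thesis
    unfolding up_closed_def and_lang_def
  proof (intro allI impI)
    fix u v assume le: "game_le k (Suc n) u v"
      and "u \<in> (\<Union>i<length Ls. Ls ! i \<inter> (\<Inter>j\<in>{..<length Ls} - {i}. Ls ! j \<cdot> UNIV))"
    then obtain i where "i < length Ls" "u \<in> Ls ! i"
      "\<forall>j\<in>{..<length Ls} - {i}. u \<in> Ls ! j \<cdot> UNIV" by auto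
    then have "i < length Ls" "v \<in> Ls ! i" "\<forall>j\<in>{..<length Ls} - {i}. v \<in> Ls ! j \<cdot> UNIV"
      using le 1 2 unfolding up_closed_def by (auto; blast)+
    then show "v \<in> (\<Union>i<length Ls. Ls ! i \<inter> (\<Inter>j\<in>{..<length Ls} - {i}. Ls ! j \<cdot> UNIV))"
      by blast
  qed
qed

lemma up_closed_Nil: "up_closed k n {[]}"
  unfolding up_closed_def by (auto dest!: game_le_same_last simp: same_last_def)

lemma up_closed_foldr_lconc:
  assumes "\<forall>L \<in> set Ls. \<exists>n. up_closed k n L"
  shows "\<exists>n. up_closed k n (foldr (\<cdot>) Ls {[]})"
  using assms
proof (induction Ls)
  case Nil
  show ?case using up_closed_Nil by auto
next
  case (Cons L Ls)
  then obtain n n' where n: "up_closed k n L" "up_closed k n' (foldr (\<cdot>) Ls {[]})" by auto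
  have "up_closed k (Suc (max n n')) (L \<cdot> foldr (\<cdot>) Ls {[]})"
    by (intro up_closed_lconc up_closed_mono[OF n(1)] up_closed_mono[OF n(2)]) auto
  then show ?case by auto
qed

lemma up_closed_sem:
  assumes "t \<in> ADT" "cd t \<le> k"
  shows "\<exists>n. up_closed k n (sem t)"
  using assms
proof (induction arbitrary: k rule: ADT.induct)
  case 1
  show ?case using up_closed_Nil by auto
next
  case (2 \<gamma>)
  have "up_closed k 0 (sem (Leaf \<gamma>))"
    by (auto simp: up_closed_def same_last_def)
  then show ?case ..
next
  case (3 ts)
  then have "\<forall>L \<in> set (map sem ts). \<exists>n. up_closed k n L" by auto
  then obtain n where "\<forall>L \<in> set (map sem ts). up_closed k n L"
    using up_closed_uniform by blast
  then have "up_closed k n (sem (OR ts))"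
    unfolding up_closed_def by (simp; blast)
  then show ?case ..
next
  case (4 ts)
  then have "\<forall>L \<in> set (map sem ts). \<exists>n. up_closed k n L" by auto
  then show ?case using up_closed_foldr_lconc[of "map sem ts"] by simp
next
  case (5 ts)
  then have "\<forall>L \<in> set (map sem ts). \<exists>n. up_closed k n L" by auto
  then obtain n where "\<forall>L \<in> set (map sem ts). up_closed k n L"
    using up_closed_uniform by blast
  then show ?case using up_closed_and_lang[of "map sem ts"] by auto
next
  case (6 t t')
  \<comment> \<open>The countermeasure \<open>t'\<close> has a depth strictly below
    \<open>k\<close>. A word going up at depth \<open>k\<close> goes down at depth
    \<open>k'\<close>, so the complement of \<open>sem t'\<close> is upward closed at depth
    \<open>k\<close>.\<close>
  then obtain k' where k: "k = Suc k'" "cd t' \<le> k'" "cd t \<le> k" by (cases k) auto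
  obtain n n' where n: "up_closed k n (sem t)" "up_closed k' n' (sem t')"
    using 6 k by blast
  have "up_closed k (max n n') (sem t)" "up_closed k' (max n n') (sem t')"
    using n by (auto intro: up_closed_mono)
  then have "up_closed k (max n n') (sem (Ctr t t'))"
    using game_le_dual[of k' "max n n'"] unfolding up_closed_def k by (simp; blast)
  then show ?case ..
qed

text \<open>The number of rounds depends on the tree, so a counterexample pair is required for every
  \<open>n\<close>.\<close>

lemma not_definable_inI:
  assumes "\<And>n. \<exists>u v. game_le k n u v \<and> u \<in> L \<and> v \<notin> L"
  shows "\<not> definable_in k L"
proof
  assume "definable_in k L"
  then obtain n where "up_closed k n L"
    using up_closed_sem unfolding definable_in_def ADT_upto_def by blast
  then show False using assms[of n] unfolding up_closed_def by blast
qed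

section \<open>Powers of words\<close>

abbreviation wpow :: "nat \<Rightarrow> 'a list \<Rightarrow> 'a list" where
  "wpow i u \<equiv> concat (replicate i u)"

lemma wpow_add: "wpow (i + j) u = wpow i u @ wpow j u"
  by (simp add: replicate_add)

lemma wpow_mult: "wpow i (wpow j u) = wpow (i * j) u"
  by (induction i) (simp_all add: replicate_add)

text \<open>The cut falls inside or at the border of one copy of \<open>u\<close>, which it divides
  into \<open>x'\<close> and \<open>y'\<close>.\<close>

lemma wpow_split:
  assumes "wpow i u = x @ y" "i > 0"
  obtains i1 i2 x' y' where "i = i1 + 1 + i2" "x = wpow i1 u @ x'" "y = y' @ wpow i2 u" "u = x' @ y'"
  using assms
proof (induction i arbitrary: x thesis)
  case (Suc i)
  from Suc.prems(2) consider z where "u = x @ z" "y = z @ wpow i u"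
    | z where "x = u @ z" "wpow i u = z @ y"
    by (auto simp: append_eq_append_conv2)
  then show ?case
  proof cases
    case 1
    then show ?thesis using Suc.prems(1)[of 0 i x z] by simp
  next
    case 2
    show ?thesis
    proof (cases "i = 0")
      case True
      then show ?thesis using 2 Suc.prems(1)[of 0 0 u "[]"] by simp
    next
      case False
      obtain i1 i2 x' y' where "i = i1 + 1 + i2" "z = wpow i1 u @ x'" "y = y' @ wpow i2 u" "u = x' @ y'"
        using Suc.IH[OF _ 2(2)] False by blast
      then show ?thesis using Suc.prems(1)[of "Suc i1" i2 x' y'] 2 by simp
    qed
  qed
qed simp

lemma last_wpow: "u \<noteq> [] \<Longrightarrow> i > 0 \<Longrightarrow> last (wpow i u) = last u"
  by (induction i) (auto simp: last_append)

lemma same_last_wpow: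
  "u \<noteq> [] \<Longrightarrow> i > 0 \<Longrightarrow> j > 0 \<Longrightarrow> same_last (wpow i u) (w @ wpow j u)"
  by (auto simp: same_last_def last_wpow)

text \<open>Cutting one of \<open>2 * T + 1\<close> copies leaves \<open>2 * T\<close> on the two
  sides together, so one side keeps at least \<open>T\<close>. In closed form this is
  \<open>2 ^ (n + 1) - 1\<close>.\<close>

primrec threshold :: "nat \<Rightarrow> nat" where
  "threshold 0 = 1"
| "threshold (Suc n) = 2 * threshold n + 1"

lemma threshold_pos: "threshold n > 0"
  by (induction n) auto

text \<open>Of the remaining \<open>b - 1 \<ge> 2 * T\<close> copies, \<open>min i T\<close> go to
  the right, and at least \<open>T\<close> stay on the left.\<close>

lemma balance_right:
  fixes T :: nat
  assumes "b \<ge> 2 * T + 1"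
  obtains b1 b2 where "b = b1 + 1 + b2" "b1 \<ge> T" "b2 = i \<or> b2 \<ge> T \<and> i \<ge> T"
proof (cases "i \<ge> T")
  case True
  then show ?thesis using that[of "b - 1 - T" T] assms by auto
next
  case False
  then show ?thesis using that[of "b - 1 - i" i] assms by auto
qed

lemma balance:
  fixes T :: nat
  assumes "i1 + 1 + i2 \<ge> 2 * T + 1" "j \<ge> 2 * T + 1"
  obtains j1 j2 where "j = j1 + 1 + j2" "j1 = i1 \<or> j1 \<ge> T \<and> i1 \<ge> T" "j2 = i2 \<or> j2 \<ge> T \<and> i2 \<ge> T"
proof (cases "i1 \<ge> T")
  case True
  then show ?thesis using balance_right[OF assms(2), where i = i2] that by metis
next
  case False
  then have "i2 \<ge> T" using assms by simp
  then show ?thesis using balance_right[OF assms(2), where i = i1] that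
    by (metis add.commute add.left_commute)
qed

text \<open>As for long linear orders in Ehrenfeucht-Fraisse games: the answer cuts a copy of
  \<open>u\<close> at the same place, reproduces a short side exactly and keeps a long side long.
  The hypotheses are symmetric in \<open>i\<close> and \<open>j\<close>, so the reversed comparison
  follows by induction.\<close>

lemma wpow_game_le:
  assumes "u \<noteq> []" "i \<ge> threshold n" "j \<ge> threshold n"
  shows "game_le k n (wpow i u) (wpow j u)"
  using assms
proof (induction "k + n" arbitrary: k n i j rule: less_induct)
  case less
  have pos: "i > 0" "j > 0" using less.prems threshold_pos[of n] by auto
  have sl: "same_last (wpow i u) (wpow j u)"
    using same_last_wpow[OF less.prems(1) pos, of "[]"] by simp
  show ?case
  proof (cases n)
    case 0
    then show ?thesis using sl by simp
  next
    case (Suc n')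
    have IH: "game_le k n' (wpow i u) (wpow j u)" if "j = i \<or> j \<ge> threshold n' \<and> i \<ge> threshold n'" for i j
      using less.hyps[of k n' i j] that less.prems Suc game_le_refl by auto
    have "game_le k (Suc n') (wpow i u) (wpow j u)"
    proof (rule game_le_SucI[OF sl])
      show "game_le k' (Suc n') (wpow j u) (wpow i u)" if "k = Suc k'" for k'
        using less.hyps[of k' n j i] less.prems that Suc by simp
      fix x y assume "wpow i u = x @ y"
      then obtain i1 i2 x' y' where
        s: "i = i1 + 1 + i2" "x = wpow i1 u @ x'" "y = y' @ wpow i2 u" "u = x' @ y'"
        using wpow_split pos by blast
      obtain j1 j2 where j: "j = j1 + 1 + j2" "j1 = i1 \<or> j1 \<ge> threshold n' \<and> i1 \<ge> threshold n'"
        "j2 = i2 \<or> j2 \<ge> threshold n' \<and> i2 \<ge> threshold n'"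
        using balance[where T = "threshold n'" and j = j and ?i1.0 = i1 and ?i2.0 = i2] less.prems Suc s by auto
      have "game_le k n' x (wpow j1 u @ x')" "game_le k n' y (y' @ wpow j2 u)"
        unfolding s(2,3) by (intro game_le_append IH j game_le_refl)+
      moreover have "wpow j u = (wpow j1 u @ x') @ (y' @ wpow j2 u)"
        unfolding j(1) wpow_add using s(4) by simp
      ultimately show "\<exists>x' y'. wpow j u = x' @ y' \<and> game_le k n' x x' \<and> game_le k n' y y'"
        by blast
    qed
    then show ?thesis using Suc by simp
  qed
qed

text \<open>However the pure power is cut, one side is still a long power, and \<open>v\<close> is
  hidden there. The reversed comparison takes place one depth lower, where \<open>v\<close> is below
  \<open>u\<close>.\<close>

lemma wpow_game_le_insert:
  assumes "u \<noteq> []" "i \<ge> threshold n" "a \<ge> threshold n" "b \<ge> threshold n"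
    and "\<And>k'. k = Suc k' \<Longrightarrow> game_le k' n v u"
  shows "game_le k n (wpow i u) (wpow a u @ v @ wpow b u)"
  using assms
proof (induction n arbitrary: i a b)
  case 0
  then show ?case using same_last_wpow[of u i b "wpow a u @ v"] by simp
next
  case (Suc n)
  let ?T = "threshold n"
  have dual: "game_le k' n v u" if "k = Suc k'" for k'
    using Suc.prems(5)[OF that] by (rule game_le_SucD)
  have IH: "game_le k n (wpow i u) (wpow a u @ v @ wpow b u)" if "i \<ge> ?T" "a \<ge> ?T" "b \<ge> ?T" for i a b
    using Suc.IH[OF Suc.prems(1) that] dual by blast
  have pump: "game_le k n (wpow i u) (wpow j u)" if "j = i \<or> j \<ge> ?T \<and> i \<ge> ?T" for i j
    using that wpow_game_le[OF Suc.prems(1)] game_le_refl by auto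
  show ?case
  proof (rule game_le_SucI)
    show "same_last (wpow i u) (wpow a u @ v @ wpow b u)"
      using same_last_wpow[of u i b "wpow a u @ v"] Suc.prems by simp
    show "game_le k' (Suc n) (wpow a u @ v @ wpow b u) (wpow i u)" if "k = Suc k'" for k'
    proof (rule game_le_trans)
      \<comment> \<open>By congruence \<open>v\<close> is raised to \<open>u\<close>, which yields a
        pure power with the large exponent \<open>a + 1 + b\<close>.\<close>
      show "game_le k' (Suc n) (wpow a u @ v @ wpow b u) (wpow a u @ u @ wpow b u)"
        by (intro game_le_append game_le_refl Suc.prems(5)[OF that])
      have "wpow a u @ u @ wpow b u = wpow (a + 1 + b) u"
        unfolding wpow_add by simp
      then show "game_le k' (Suc n) (wpow a u @ u @ wpow b u) (wpow i u)"
        using wpow_game_le[OF Suc.prems(1), of "Suc n" "a + 1 + b" i k'] Suc.prems by simp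
    qed
    fix x y assume xy: "wpow i u = x @ y"
    have "i > 0" using Suc.prems by simp
    then obtain i1 i2 x' y' where
      s: "i = i1 + 1 + i2" "x = wpow i1 u @ x'" "y = y' @ wpow i2 u" "u = x' @ y'"
      using wpow_split[OF xy] by blast
    \<comment> \<open>Since \<open>i \<ge> 2 * ?T + 1\<close>, the two sides of the cut cannot both
      be short.\<close>
    have "i1 \<ge> ?T \<or> i2 \<ge> ?T" using s(1) Suc.prems by auto
    then show "\<exists>x' y'. wpow a u @ v @ wpow b u = x' @ y' \<and> game_le k n x x' \<and> game_le k n y y'"
    proof
      assume i1: "i1 \<ge> ?T"
      \<comment> \<open>The answer cuts to the right of \<open>v\<close>. As
        \<open>b1 \<ge> ?T\<close>, the left part is again a long power with \<open>v\<close>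
        inserted, and the induction hypothesis applies.\<close>
      obtain b1 b2 where b: "b = b1 + 1 + b2" "b1 \<ge> ?T" "b2 = i2 \<or> b2 \<ge> ?T \<and> i2 \<ge> ?T"
        using balance_right[where T = ?T and b = b and i = i2] Suc.prems by auto
      have "game_le k n x ((wpow a u @ v @ wpow b1 u) @ x')" "game_le k n y (y' @ wpow b2 u)"
        unfolding s(2,3) using Suc.prems i1 b
        by (intro game_le_append IH pump game_le_refl; simp)+
      moreover have "wpow a u @ v @ wpow b u = ((wpow a u @ v @ wpow b1 u) @ x') @ (y' @ wpow b2 u)"
        unfolding b(1) wpow_add using s(4) by simp
      ultimately show ?thesis by blast
    next
      assume i2: "i2 \<ge> ?T"
      obtain a1 a2 where a: "a = a2 + 1 + a1" "a2 \<ge> ?T" "a1 = i1 \<or> a1 \<ge> ?T \<and> i1 \<ge> ?T"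
        using balance_right[where T = ?T and b = a and i = i1] Suc.prems by auto
      have "game_le k n x (wpow a1 u @ x')" "game_le k n y (y' @ wpow a2 u @ v @ wpow b u)"
        unfolding s(2,3) using Suc.prems i2 a
        by (intro game_le_append IH pump game_le_refl; simp)+
      moreover have "a = a1 + 1 + a2" using a(1) by simp
      then have "wpow a u @ v @ wpow b u = (wpow a1 u @ x') @ (y' @ wpow a2 u @ v @ wpow b u)"
        using s(4) by (simp only: wpow_add) simp
      ultimately show ?thesis by blast
    qed
  qed
qed

section \<open>Words that the preorders relate\<close>

text \<open>If \<open>a\<close> is a step up and \<open>b\<close> a step down, the middle copy in
  each level runs one unit higher. The outer power makes the word pumpable.\<close>

primrec zigzag :: "'a \<Rightarrow> 'a \<Rightarrow> nat \<Rightarrow> nat \<Rightarrow> 'a list" where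
  "zigzag a b N 0 = wpow N [a, b, a, b, a, b]"
| "zigzag a b N (Suc m) =
     wpow N (zigzag a b N m @ a # zigzag a b N m @ b # zigzag a b N m)"

text \<open>Both sides are powers of one word, with exponents \<open>N + N\<close> and
  \<open>N\<close>.\<close>

lemma zigzag_idem:
  assumes "N = threshold n"
  shows "game_le k n (zigzag a b N m @ zigzag a b N m) (zigzag a b N m)"
proof -
  obtain u where u: "u \<noteq> []" "zigzag a b N m = wpow N u"
    by (cases m) auto
  show ?thesis
    unfolding u(2) wpow_add[symmetric] using u(1) assms by (intro wpow_game_le; simp)
qed

text \<open>One depth lower \<open>?v\<close> is below \<open>?u\<close>, so it can be inserted into
  the power of \<open>?u\<close>. The parts of \<open>?v\<close> around \<open>c\<close> are then
  absorbed by the neighbouring powers.\<close>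

lemma zigzag_insert:
  assumes N: "N = threshold n" and "c = a \<or> c = b"
  shows "game_le (Suc m) n (zigzag a b N m) (zigzag a b N m @ c # zigzag a b N m)"
  using assms(2)
proof (induction m arbitrary: c)
  case 0
  let ?u = "[a, b, a, b, a, b]" and ?v = "[a, b] @ [c] @ [a, b]"
  \<comment> \<open>The letter \<open>c\<close> grows to two letters ending in \<open>c\<close>:
    \<open>[a]\<close> to \<open>[b, a]\<close>, or \<open>[b]\<close> to
    \<open>[a, b]\<close>.\<close>
  have "game_le 0 n ?v ?u"
  proof (cases "c = a")
    case True
    have "game_le 0 n ([a, b, a] @ [a] @ [b]) ([a, b, a] @ [b, a] @ [b])"
      by (intro game_le_append game_le_refl game_le_0_Cons)
    then show ?thesis using True by simp
  next
    case False
    have "game_le 0 n ([a, b] @ [b] @ [a, b]) ([a, b] @ [a, b] @ [a, b])"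
      by (intro game_le_append game_le_refl game_le_0_Cons)
    then show ?thesis using False 0 by simp
  qed
  then have 1: "game_le (Suc 0) n (wpow N ?u) (wpow N ?u @ ?v @ wpow N ?u)"
    by (intro wpow_game_le_insert) (auto simp: N)
  \<comment> \<open>As a power of \<open>[a, b]\<close> the word absorbs a further
    \<open>[a, b]\<close> on either side.\<close>
  have u: "wpow N ?u = wpow (N * 3) [a, b]"
    using wpow_mult[of N 3 "[a, b]"] by (simp add: numeral_3_eq_3)
  have l: "game_le (Suc 0) n (wpow N ?u @ [a, b]) (wpow N ?u)"
    using wpow_game_le[of "[a, b]" n "N * 3 + 1" "N * 3" "Suc 0"]
    unfolding u wpow_add by (simp add: N)
  have r: "game_le (Suc 0) n ([a, b] @ wpow N ?u) (wpow N ?u)"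
    using wpow_game_le[of "[a, b]" n "1 + N * 3" "N * 3" "Suc 0"]
    unfolding u wpow_add by (simp add: N)
  have "game_le (Suc 0) n ((wpow N ?u @ [a, b]) @ [c] @ ([a, b] @ wpow N ?u))
     (wpow N ?u @ [c] @ wpow N ?u)"
    by (intro game_le_append game_le_refl l r)
  then show ?case using game_le_trans[OF 1] by simp
next
  case (Suc m)
  let ?q = "zigzag a b N m"
  let ?u = "?q @ a # ?q @ b # ?q" and ?v = "?q @ [c] @ ?q" and ?k = "Suc (Suc m)"
  \<comment> \<open>The induction hypothesis inserts the missing letter: \<open>b\<close> into the
    last \<open>?q\<close> if \<open>c = a\<close>, and \<open>a\<close> into the first
    \<open>?q\<close> if \<open>c = b\<close>.\<close>
  have "game_le (Suc m) n ?v ?u"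
  proof (cases "c = a")
    case True
    have "game_le (Suc m) n ((?q @ [a]) @ ?q) ((?q @ [a]) @ ?q @ b # ?q)"
      by (intro game_le_append game_le_refl Suc.IH) simp
    then show ?thesis using True by simp
  next
    case False
    have "game_le (Suc m) n (?q @ [b] @ ?q) ((?q @ a # ?q) @ [b] @ ?q)"
      by (intro game_le_append game_le_refl Suc.IH) simp
    then show ?thesis using False Suc.prems by simp
  qed
  then have 1: "game_le ?k n (wpow N ?u) (wpow N ?u @ ?v @ wpow N ?u)"
    by (intro wpow_game_le_insert) (auto simp: N)
  \<comment> \<open>Splitting off one copy of \<open>?u\<close> shows that the power begins and ends
    with \<open>?q\<close>, so an adjacent \<open>?q\<close> is absorbed by
    \<open>zigzag_idem\<close>.\<close>
  obtain M where M: "N = Suc M" using threshold_pos[of n] N gr0_implies_Suc by blast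
  have idem: "game_le ?k n (?q @ ?q) ?q" using zigzag_idem[OF N] .
  have r: "game_le ?k n (?q @ wpow N ?u) (wpow N ?u)"
  proof -
    have "game_le ?k n ((?q @ ?q) @ (a # ?q @ b # ?q) @ wpow M ?u) (?q @ (a # ?q @ b # ?q) @ wpow M ?u)"
      by (intro game_le_append game_le_refl idem)
    then show ?thesis by (simp add: M)
  qed
  have l: "game_le ?k n (wpow N ?u @ ?q) (wpow N ?u)"
  proof -
    have e: "wpow N ?u = wpow M ?u @ (?q @ a # ?q @ [b]) @ ?q"
      using wpow_add[of M 1 ?u] by (simp add: M)
    have "game_le ?k n (wpow M ?u @ (?q @ a # ?q @ [b]) @ (?q @ ?q)) (wpow M ?u @ (?q @ a # ?q @ [b]) @ ?q)"
      by (intro game_le_append game_le_refl idem)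
    then show ?thesis unfolding e by simp
  qed
  have "game_le ?k n ((wpow N ?u @ ?q) @ [c] @ (?q @ wpow N ?u)) (wpow N ?u @ [c] @ wpow N ?u)"
    by (intro game_le_append game_le_refl l r)
  then show ?case using game_le_trans[OF 1] by simp
qed

section \<open>Closure properties of definability\<close>

lemma definable_in_mono: "definable_in k L \<Longrightarrow> k \<le> k' \<Longrightarrow> definable_in k' L"
  unfolding definable_in_def ADT_upto_def by auto

lemma definable_in_Nil: "definable_in k {[]}"
  unfolding definable_in_def ADT_upto_def by (rule bexI[of _ Eps]) (auto intro: ADT.intros)

lemma definable_in_Leaf: "definable_in k (sem (Leaf \<gamma>))"
  unfolding definable_in_def ADT_upto_def by (rule bexI[of _ "Leaf \<gamma>"]) (auto intro: ADT.intros)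

lemma definable_in_empty: "definable_in k {}"
  using definable_in_Leaf[of k "Conj (Atom p) (Neg (Atom p))" for p] by simp

lemma definable_in_Un:
  assumes "definable_in k K" "definable_in k L"
  shows "definable_in k (K \<union> L)"
proof -
  obtain s t where "s \<in> ADT" "cd s \<le> k" "K = sem s" "t \<in> ADT" "cd t \<le> k" "L = sem t"
    using assms by (auto simp: definable_in_def ADT_upto_def)
  then show ?thesis unfolding definable_in_def ADT_upto_def
    by (intro bexI[of _ "OR [s, t]"]) (auto intro: ADT.intros)
qed

lemma definable_in_lconc:
  assumes "definable_in k K" "definable_in k L"
  shows "definable_in k (K \<cdot> L)"
proof -
  obtain s t where "s \<in> ADT" "cd s \<le> k" "K = sem s" "t \<in> ADT" "cd t \<le> k" "L = sem t"
    using assms by (auto simp: definable_in_def ADT_upto_def)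
  then show ?thesis unfolding definable_in_def ADT_upto_def
    by (intro bexI[of _ "SAND [s, t]"]) (auto intro: ADT.intros simp: lconc_def)
qed

lemma definable_in_UN:
  assumes "finite I" "\<And>i. i \<in> I \<Longrightarrow> definable_in k (L i)"
  shows "definable_in k (\<Union>i\<in>I. L i)"
  using assms by (induction I) (auto intro: definable_in_empty definable_in_Un)

lemma definable_in_Diff:
  assumes "definable_in (Suc k) K" "definable_in k L"
  shows "definable_in (Suc k) (K - L)"
proof -
  obtain s t where "s \<in> ADT" "cd s \<le> Suc k" "K = sem s" "t \<in> ADT" "cd t \<le> k" "L = sem t"
    using assms by (auto simp: definable_in_def ADT_upto_def)
  then show ?thesis unfolding definable_in_def ADT_upto_def
    by (intro bexI[of _ "Ctr s t"]) (auto intro: ADT.intros)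
qed

lemma definable_in_nonempty: "definable_in k {w :: 'p trace. w \<noteq> []}"
  using definable_in_Leaf[of k "Disj (Atom p) (Neg (Atom p))" for p] by simp

lemma definable_in_UNIV: "definable_in k (UNIV :: 'p trace set)"
proof -
  have "(UNIV :: 'p trace set) = {[]} \<union> {w. w \<noteq> []}" by auto
  then show ?thesis
    using definable_in_Un[OF definable_in_Nil definable_in_nonempty] by metis
qed

lemma definable_in_Compl: "definable_in k L \<Longrightarrow> definable_in (Suc k) (- L)"
  using definable_in_Diff[OF definable_in_UNIV] by (simp add: Compl_eq_Diff_UNIV)

text \<open>One-letter words are the nonempty words that are not a product of two nonempty words;
  excluding these products takes one countermeasure.\<close>

lemma definable_in_letter: "definable_in (Suc k) {[v] |v. v \<Turnstile> \<gamma>}"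
proof -
  have "w \<in> sem (Leaf \<gamma>) - {w. w \<noteq> []} \<cdot> {w. w \<noteq> []} \<longleftrightarrow> w \<in> {[v] |v. v \<Turnstile> \<gamma>}" for w
  proof (cases w)
    case (Cons c w')
    show ?thesis
    proof (cases "w' = []")
      case False
      then have "w = [c] @ w'" "[c] \<noteq> []" "w' \<noteq> []" using Cons by auto
      then have "w \<in> {w. w \<noteq> []} \<cdot> {w. w \<noteq> []}" unfolding lconc_def by blast
      then show ?thesis using Cons False by auto
    qed (auto simp: Cons lconc_def Cons_eq_append_conv)
  qed (auto simp: lconc_def)
  then have "{[v] |v. v \<Turnstile> \<gamma>} = sem (Leaf \<gamma>) - {w. w \<noteq> []} \<cdot> {w. w \<noteq> []}" by blast
  then show ?thesis
    by (metis definable_in_Diff definable_in_Leaf definable_in_lconc definable_in_nonempty)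
qed

section \<open>Paths of bounded height\<close>

definition step :: "'p \<Rightarrow> 'p set \<Rightarrow> int" where
  "step p v = (if p \<in> v then 1 else - 1)"

text \<open>All visited heights, both ends included, lie in \<open>[0, m]\<close>. Integer heights
  let a step down from \<open>0\<close> leave the strip.\<close>

fun path :: "'p \<Rightarrow> int \<Rightarrow> int \<Rightarrow> 'p trace \<Rightarrow> int \<Rightarrow> bool" where
  "path p m i [] j \<longleftrightarrow> 0 \<le> i \<and> i \<le> m \<and> i = j"
| "path p m i (v # w) j \<longleftrightarrow> 0 \<le> i \<and> i \<le> m \<and> path p m (i + step p v) w j"

abbreviation paths :: "'p \<Rightarrow> int \<Rightarrow> int \<Rightarrow> int \<Rightarrow> 'p trace set" where
  "paths p m i j \<equiv> {w. path p m i w j}"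

definition ups :: "'p \<Rightarrow> 'p trace set" where "ups p = {[v] |v. v \<Turnstile> Atom p}"
definition downs :: "'p \<Rightarrow> 'p trace set" where "downs p = {[v] |v. v \<Turnstile> Neg (Atom p)}"

lemma path_append: "path p m i (u @ w) j \<longleftrightarrow> (\<exists>l. path p m i u l \<and> path p m l w j)"
  by (induction u arbitrary: i) (auto, (case_tac w; auto)+)

lemma path_range: "path p m i w j \<Longrightarrow> 0 \<le> i \<and> i \<le> m \<and> 0 \<le> j \<and> j \<le> m"
  by (induction w arbitrary: i) auto

text \<open>Both differences equal the sum of the steps of \<open>w\<close>.\<close>

lemma path_unique:
  "path p m i w j \<Longrightarrow> path p m' i' w j' \<Longrightarrow> j' - i' = j - i"
  by (induction w arbitrary: i i') (auto, fastforce)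

text \<open>Either \<open>w\<close> stays in the strip, or \<open>v\<close> is the letter at which it first leaves the strip.\<close>

lemma path_exit:
  assumes "0 \<le> i" "i \<le> m"
  shows "(\<exists>l. path p m i w l) \<or> (\<exists>x v y. w = x @ v # y \<and> p \<notin> v \<and> path p m i x 0)
    \<or> (\<exists>x v y. w = x @ v # y \<and> p \<in> v \<and> path p m i x m)"
  using assms
proof (induction w arbitrary: i)
  case (Cons v w)
  consider "p \<notin> v" "i = 0" | "p \<in> v" "i = m" | "0 \<le> i + step p v" "i + step p v \<le> m"
    using Cons.prems by (cases "p \<in> v"; force simp: step_def)
  then show ?case
  proof cases
    case 1
    then have "v # w = [] @ v # w \<and> p \<notin> v \<and> path p m i [] 0" using Cons.prems by simp
    then show ?thesis by blast
  next
    case 2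
    then have "v # w = [] @ v # w \<and> p \<in> v \<and> path p m i [] m" using Cons.prems by simp
    then show ?thesis by blast
  next
    case 3
    from Cons.IH[OF 3] consider l where "path p m (i + step p v) w l"
      | x v' y where "w = x @ v' # y" "p \<notin> v'" "path p m (i + step p v) x 0"
      | x v' y where "w = x @ v' # y" "p \<in> v'" "path p m (i + step p v) x m"
      by blast
    then show ?thesis
    proof cases
      case 1
      then show ?thesis using Cons.prems by auto
    next
      case 2
      then have "v # w = (v # x) @ v' # y \<and> p \<notin> v' \<and> path p m i (v # x) 0" using Cons.prems by simp
      then show ?thesis using 2 by blast
    next
      case 3
      then have "v # w = (v # x) @ v' # y \<and> p \<in> v' \<and> path p m i (v # x) m" using Cons.prems by simp
      then show ?thesis using 3 by blast
    qed
  qed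
qed auto

text \<open>In the second case, \<open>v\<close> is the step down after the last visit of the height \<open>m\<close>.\<close>

lemma path_last_top:
  assumes "path p m i w l" "l < m"
  shows "path p (m - 1) i w l \<or>
    (\<exists>x v y. w = x @ v # y \<and> p \<notin> v \<and> path p (m - 1) (m - 1) y l)"
  using assms(1)
proof (induction w arbitrary: i)
  case Nil
  then show ?case using assms(2) by simp
next
  case (Cons v w)
  then have i: "0 \<le> i" "i \<le> m" "path p m (i + step p v) w l" by auto
  from Cons.IH[OF i(3)] show ?case
  proof
    assume w: "path p (m - 1) (i + step p v) w l"
    show ?thesis
    proof (cases "i = m")
      case True
      then have "p \<notin> v" using path_range[OF w] by (auto simp: step_def split: if_splits)
      then have "v # w = [] @ v # w \<and> p \<notin> v \<and> path p (m - 1) (m - 1) w l"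
        using w True by (simp add: step_def)
      then show ?thesis by blast
    qed (use w i in auto)
  qed (metis append_Cons)
qed

text \<open>Mirror image of \<open>path_last_top\<close>: a path avoiding \<open>0\<close> lives in
  \<open>[1, m]\<close>, which is lowered by one. Otherwise \<open>v\<close> is the step up after
  the last visit of \<open>0\<close>.\<close>

lemma path_last_bottom:
  assumes "path p m i w l" "0 < l"
  shows "path p (m - 1) (i - 1) w (l - 1) \<or>
    (\<exists>x v y. w = x @ v # y \<and> p \<in> v \<and> path p (m - 1) 0 y (l - 1))"
  using assms(1)
proof (induction w arbitrary: i)
  case Nil
  then show ?case using assms(2) by simp
next
  case (Cons v w)
  then have i: "0 \<le> i" "i \<le> m" "path p m (i + step p v) w l" by auto
  from Cons.IH[OF i(3)] show ?case
  proof
    assume w: "path p (m - 1) (i + step p v - 1) w (l - 1)"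
    show ?thesis
    proof (cases "i = 0")
      case True
      then have "p \<in> v" using path_range[OF w] by (auto simp: step_def split: if_splits)
      then have "v # w = [] @ v # w \<and> p \<in> v \<and> path p (m - 1) 0 w (l - 1)"
        using w True by (simp add: step_def)
      then show ?thesis by blast
    qed (use w i in \<open>auto simp: algebra_simps\<close>)
  qed (metis append_Cons)
qed

text \<open>The first four languages describe leaving the strip, through the bottom or the top,
  without or with an earlier visit of the opposite border. The last four describe a wrong final
  height \<open>l\<close>. Shifts by one lower the strip \<open>[1, m]\<close> to
  \<open>[0, m - 1]\<close>.\<close>

lemma paths_Compl:
  assumes m: "0 < m" and i: "0 \<le> i" "i \<le> m" and j: "0 \<le> j" "j \<le> m"
  shows "- paths p m i j =
      paths p (m - 1) i 0 \<cdot> downs p \<cdot> UNIV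
    \<union> paths p (m - 1) (i - 1) (m - 1) \<cdot> ups p \<cdot> UNIV
    \<union> UNIV \<cdot> downs p \<cdot> paths p (m - 1) (m - 1) 0 \<cdot> downs p \<cdot> UNIV
    \<union> UNIV \<cdot> ups p \<cdot> paths p (m - 1) 0 (m - 1) \<cdot> ups p \<cdot> UNIV
    \<union> (\<Union>l\<in>{j<..m}. UNIV \<cdot> ups p \<cdot> paths p (m - 1) 0 (l - 1))
    \<union> (\<Union>l\<in>{j<..m}. paths p (m - 1) (i - 1) (l - 1))
    \<union> (\<Union>l\<in>{0..<j}. UNIV \<cdot> downs p \<cdot> paths p (m - 1) (m - 1) l)
    \<union> (\<Union>l\<in>{0..<j}. paths p (m - 1) i l)" (is "_ = ?R")
proof (intro equalityI subsetI)
  fix w assume "w \<in> - paths p m i j"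
  then have not_path: "\<not> path p m i w j" by simp
  have downI: "[v] \<in> downs p" if "p \<notin> v" for v using that by (simp add: downs_def)
  have upI: "[v] \<in> ups p" if "p \<in> v" for v using that by (simp add: ups_def)
  have lconcI: "x @ y \<in> K \<cdot> L" if "x \<in> K" "y \<in> L" for x y :: "'a trace" and K L
    using that by (auto simp: lconc_def)
  from path_exit[OF i, of p w] consider l where "path p m i w l"
    | x v y where "w = x @ v # y" "p \<notin> v" "path p m i x 0"
    | x v y where "w = x @ v # y" "p \<in> v" "path p m i x m"
    by blast
  then show "w \<in> ?R"
  proof cases
    case 1
    then have l: "l \<noteq> j" "0 \<le> l" "l \<le> m" using not_path path_range[OF 1] 1 by auto
    show ?thesis
    \<comment> \<open>A path ending below \<open>j\<close> finally stays off the top, one ending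
      above \<open>j\<close> finally stays off the bottom.\<close>
    proof (cases "l < j")
      case True
      then have "l < m" using j by simp
      from path_last_top[OF 1 this] show ?thesis
      proof
        assume "\<exists>x v y. w = x @ v # y \<and> p \<notin> v \<and> path p (m - 1) (m - 1) y l"
        then obtain x v y where w: "w = x @ [v] @ y" "p \<notin> v" "path p (m - 1) (m - 1) y l" by auto
        have "w \<in> UNIV \<cdot> downs p \<cdot> paths p (m - 1) (m - 1) l"
          unfolding w(1) using w downI by (intro lconcI) auto
        then show ?thesis using True l by auto
      qed (use True l in auto)
    next
      case False
      then have "0 < l" "j < l" using j l by auto
      from path_last_bottom[OF 1 this(1)] show ?thesis
      proof
        assume "\<exists>x v y. w = x @ v # y \<and> p \<in> v \<and> path p (m - 1) 0 y (l - 1)"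
        then obtain x v y where w: "w = x @ [v] @ y" "p \<in> v" "path p (m - 1) 0 y (l - 1)" by auto
        have "w \<in> UNIV \<cdot> ups p \<cdot> paths p (m - 1) 0 (l - 1)"
          unfolding w(1) using w upI by (intro lconcI) auto
        then show ?thesis using \<open>j < l\<close> l by auto
      qed (use \<open>j < l\<close> l in auto)
    qed
  next
    case 2
    \<comment> \<open>The prefix before the exit ends at \<open>0\<close>, hence below the
      top.\<close>
    from path_last_top[OF 2(3) m] show ?thesis
    proof
      assume "path p (m - 1) i x 0"
      then have "x @ [v] @ y \<in> paths p (m - 1) i 0 \<cdot> downs p \<cdot> UNIV"
        using 2 downI by (intro lconcI) auto
      then show ?thesis using 2 by simp
    next
      assume "\<exists>x' v y. x = x' @ v # y \<and> p \<notin> v \<and> path p (m - 1) (m - 1) y 0"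
      then obtain x' v' y' where x: "x = x' @ [v'] @ y'" "p \<notin> v'" "path p (m - 1) (m - 1) y' 0"
        by auto
      have "x' @ [v'] @ y' @ [v] @ y
          \<in> UNIV \<cdot> downs p \<cdot> paths p (m - 1) (m - 1) 0 \<cdot> downs p \<cdot> UNIV"
        using 2 x downI by (intro lconcI) auto
      then show ?thesis using 2 x by simp
    qed
  next
    case 3
    from path_last_bottom[OF 3(3) m] show ?thesis
    proof
      assume "path p (m - 1) (i - 1) x (m - 1)"
      then have "x @ [v] @ y \<in> paths p (m - 1) (i - 1) (m - 1) \<cdot> ups p \<cdot> UNIV"
        using 3 upI by (intro lconcI) auto
      then show ?thesis using 3 by simp
    next
      assume "\<exists>x' v y. x = x' @ v # y \<and> p \<in> v \<and> path p (m - 1) 0 y (m - 1)"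
      then obtain x' v' y' where x: "x = x' @ [v'] @ y'" "p \<in> v'" "path p (m - 1) 0 y' (m - 1)"
        by auto
      have "x' @ [v'] @ y' @ [v] @ y
          \<in> UNIV \<cdot> ups p \<cdot> paths p (m - 1) 0 (m - 1) \<cdot> ups p \<cdot> UNIV"
        using 3 x upI by (intro lconcI) auto
      then show ?thesis using 3 x by simp
    qed
  qed
next
  fix w assume "w \<in> ?R"
  then consider 
      x v y where "w = x @ [v] @ y" "path p (m - 1) i x 0" "p \<notin> v"
    | x v y where "w = x @ [v] @ y" "path p (m - 1) (i - 1) x (m - 1)" "p \<in> v"
    | x v y v' z where "w = x @ [v] @ y @ [v'] @ z" "p \<notin> v" "path p (m - 1) (m - 1) y 0" "p \<notin> v'"
    | x v y v' z where "w = x @ [v] @ y @ [v'] @ z" "p \<in> v" "path p (m - 1) 0 y (m - 1)" "p \<in> v'"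
    | x v y l where "j < l" "w = x @ [v] @ y" "p \<in> v" "path p (m - 1) 0 y (l - 1)"
    | l where "j < l" "path p (m - 1) (i - 1) w (l - 1)"
    | x v y l where "l < j" "w = x @ [v] @ y" "p \<notin> v" "path p (m - 1) (m - 1) y l"
    | l where "l < j" "path p (m - 1) i w l"
    unfolding lconc_def ups_def downs_def by (auto; force)
  \<comment> \<open>The net height of the named factor is fixed by \<open>path_unique\<close>. In
    each case it forces a height outside \<open>[0, m]\<close> or an end other than
    \<open>j\<close>.\<close>
  then show "w \<in> - paths p m i j"
  proof cases
    case 1
    then show ?thesis
      by (auto simp: path_append step_def dest!: path_range path_unique[OF 1(2)])
  next
    case 2
    then show ?thesis
      by (auto simp: path_append step_def dest!: path_range path_unique[OF 2(2)])
  next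
    case 3
    then show ?thesis
      by (auto simp: path_append step_def dest!: path_range path_unique[OF 3(3)])
  next
    case 4
    then show ?thesis
      by (auto simp: path_append step_def dest!: path_range path_unique[OF 4(3)])
  next
    case 5
    then show ?thesis
      by (auto simp: path_append step_def dest!: path_range path_unique[OF 5(4)])
  next
    case 6
    then show ?thesis by (auto dest!: path_unique[OF 6(2)])
  next
    case 7
    then show ?thesis
      by (auto simp: path_append step_def dest!: path_range path_unique[OF 7(4)])
  next
    case 8
    then show ?thesis by (auto dest!: path_unique[OF 8(2)])
  qed
qed

text \<open>By \<open>paths_Compl\<close> the complement is built from strips of height one less
  without countermeasures, so each unit of height costs one complementation. The letters
  \<open>ups p\<close> and \<open>downs p\<close> already need depth 1, hence the offset
  \<open>Suc m\<close>.\<close>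

lemma definable_in_paths: "definable_in (Suc m) (paths p (int m) i j)"
proof (induction m arbitrary: i j)
  case 0
  \<comment> \<open>Any step leaves the strip \<open>[0, 0]\<close>.\<close>
  have "path p 0 i w j \<longleftrightarrow> w = [] \<and> i = 0 \<and> j = 0" for w
    using path_range[of p 0] by (cases w) (fastforce simp: step_def split: if_splits)+
  then have "paths p (int 0) i j = (if i = 0 \<and> j = 0 then {[]} else {})" by auto
  then show ?case using definable_in_Nil definable_in_empty by auto
next
  case (Suc m)
  show ?case
  proof (cases "0 \<le> i \<and> i \<le> int (Suc m) \<and> 0 \<le> j \<and> j \<le> int (Suc m)")
    case True
    have letters: "definable_in (Suc m) (ups p)" "definable_in (Suc m) (downs p)"
      unfolding ups_def downs_def by (rule definable_in_letter)+
    have IH: "definable_in (Suc m) (paths p (int (Suc m) - 1) i' j')" for i' j'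
      using Suc.IH by simp
    have "definable_in (Suc m) (- paths p (int (Suc m)) i j)"
      by (subst paths_Compl)
        (use True in \<open>simp_all only: of_nat_0_less_iff zero_less_Suc,
          intro definable_in_Un definable_in_UN definable_in_lconc letters IH
          definable_in_UNIV finite_greaterThanAtMost_int finite_atLeastLessThan_int\<close>)
    from definable_in_Compl[OF this] show ?thesis by simp
  next
    case False
    then have "paths p (int (Suc m)) i j = {}" by (auto dest: path_range)
    then show ?thesis using definable_in_empty by metis
  qed
qed

section \<open>Zigzag words as paths in a strip\<close>

lemma path_wpow:
  assumes "path p m i u i"
  shows "path p m i (wpow N u) i"
  using assms by (induction N) (auto simp: path_append dest: path_range)

text \<open>Translation by \<open>d\<close> takes \<open>[0, m]\<close> to
  \<open>[d, m + d]\<close>, which lies in \<open>[0, m + e]\<close>.\<close>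

lemma path_weaken:
  "path p m i w j \<Longrightarrow> 0 \<le> d \<Longrightarrow> d \<le> e \<Longrightarrow> path p (m + e) (i + d) w (j + d)"
proof (induction w arbitrary: i)
  case (Cons v w)
  then have "path p (m + e) (i + step p v + d) w (j + d)" by simp
  then show ?case using Cons.prems by (simp add: add.assoc add.commute[of d])
qed simp

lemma path_zigzag:
  assumes "p \<in> a" "p \<notin> b"
  shows "path p (int m + 1) 0 (zigzag a b N m) 0"
proof (induction m)
  case 0
  have "path p 1 0 [a, b, a, b, a, b] 0" using assms by (simp add: step_def)
  then show ?case using path_wpow by fastforce
next
  case (Suc m)
  \<comment> \<open>The outer copies run at height \<open>0\<close>, the middle copy at height
    \<open>1\<close>.\<close>
  have lo: "path p (int m + 2) 0 (zigzag a b N m) 0" and hi: "path p (int m + 2) 1 (zigzag a b N m) 1"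
    using path_weaken[OF Suc, of 0 1] path_weaken[OF Suc, of 1 1] by (simp_all add: algebra_simps)
  have "path p (int m + 2) 0 ([a] @ zigzag a b N m @ b # zigzag a b N m) 0"
    using lo hi assms by (auto simp: path_append step_def intro!: exI[of _ 1])
  then have "path p (int m + 2) 0 (zigzag a b N m @ a # zigzag a b N m @ b # zigzag a b N m) 0"
    using lo by (auto simp: path_append[of _ _ _ "zigzag a b N m" "a # _"])
  then have "path p (int m + 2) 0 (zigzag a b N (Suc m)) 0"
    using path_wpow by fastforce
  then show ?case by (simp add: algebra_simps)
qed

section \<open>Strictness\<close>

lemma strict_witness:
  "\<exists>L :: 'p trace set. definable_in (Suc k) L \<and> \<not> definable_in k L"
proof (cases k)
  \<comment> \<open>The strip of height \<open>0\<close> contains only the empty path, whose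
    language has depth 0. The witness here is the set of words none of whose letters contains
    \<open>p\<close>.\<close>
  case 0
  fix p :: 'p
  let ?L = "- (sem (Leaf (Atom p)) \<cdot> UNIV)"
  have "definable_in (Suc 0) ?L"
    by (intro definable_in_Compl definable_in_lconc definable_in_Leaf definable_in_UNIV)
  moreover have "\<not> definable_in 0 ?L"
  proof (rule not_definable_inI)
    fix n
    let ?u = "wpow (threshold n) [{} :: 'p set]"
    have "game_le 0 n ?u (?u @ [{p}] @ ?u)"
      by (rule wpow_game_le_insert) auto
    moreover have "?u \<in> ?L"
    proof
      assume "?u \<in> sem (Leaf (Atom p)) \<cdot> UNIV"
      then obtain x y where "?u = x @ y" "x \<noteq> []" "p \<in> last x" by (auto simp: lconc_def)
      then have "last x \<in> set ?u" by (metis Un_iff last_in_set set_append)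
      then show False using \<open>p \<in> last x\<close> by simp
    qed
    moreover have "(?u @ [{p}]) @ ?u \<in> sem (Leaf (Atom p)) \<cdot> UNIV"
      unfolding lconc_def by (intro CollectI exI[of _ "?u @ [{p}]"] exI[of _ ?u] conjI refl) simp_all
    then have "?u @ [{p}] @ ?u \<notin> ?L" by (simp del: sem.simps)
    ultimately show "\<exists>u v. game_le 0 n u v \<and> u \<in> ?L \<and> v \<notin> ?L" by blast
  qed
  ultimately show ?thesis using 0 by blast
next
  \<comment> \<open>Level \<open>m\<close> of \<open>zigzag\<close> fits both demands: insertion
    goes up at depth \<open>m + 1 = k\<close>, and the path has height
    \<open>m + 1 = k\<close>.\<close>
  case (Suc m)
  fix p :: 'p
  let ?L = "paths p (int k) 0 0"
  have "\<not> definable_in k ?L"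
  proof (rule not_definable_inI)
    fix n
    let ?q = "zigzag {p} {} (threshold n) m"
    have q: "path p (int k) 0 ?q 0"
      using path_zigzag[of p "{p}" "{}" m] Suc by (simp add: algebra_simps)
    have "game_le k n ?q (?q @ {p} # ?q)" unfolding Suc by (rule zigzag_insert) simp_all
    \<comment> \<open>Each copy of \<open>?q\<close> has net height \<open>0\<close>, so the whole
      word has net height \<open>1\<close>.\<close>
    moreover have "\<not> path p (int k) 0 (?q @ {p} # ?q) 0"
    proof
      assume "path p (int k) 0 (?q @ {p} # ?q) 0"
      then obtain l where "path p (int k) 0 ?q l" "path p (int k) (l + 1) ?q 0"
        by (auto simp: path_append step_def)
      then show False using path_unique[OF q, of "int k" 0 l] path_unique[OF q, of "int k" "l + 1" 0]
        by simp
    qed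
    ultimately show "\<exists>u v. game_le k n u v \<and> u \<in> ?L \<and> v \<notin> ?L" using q by blast
  qed
  then show ?thesis using definable_in_paths[of k p 0 0] by blast
qed

theorem proposition1:
  "(\<forall>k. {L :: 'p::finite trace set. definable_in k L} \<subset> {L. definable_in (k + 1) L}) \<and>
   (\<forall>k. {L :: unit trace set. definable_in k L} \<subset> {L. definable_in (k + 1) L})"
proof -
  \<comment> \<open>The type \<open>'q\<close> is arbitrary here, so the fact can be instantiated
    both to \<open>'p\<close> and to \<open>unit\<close>, the singleton set of propositions.\<close>
  have strict: "{L :: 'q trace set. definable_in k L} \<subset> {L. definable_in (k + 1) L}" for k
  proof (rule psubsetI)
    show "{L :: 'q trace set. definable_in k L} \<subseteq> {L. definable_in (k + 1) L}"
      by (auto intro: definable_in_mono)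
    obtain L :: "'q trace set" where "definable_in (k + 1) L" "\<not> definable_in k L"
      using strict_witness[of k] by auto
    then show "{L :: 'q trace set. definable_in k L} \<noteq> {L. definable_in (k + 1) L}" by auto
  qed
  show ?thesis by (intro conjI allI strict)
qed

end
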